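(* As $n\to\infty$, \[(3+o(1))\binom{n}{\lfloor n/2\rfloor}\le \mathrm{La}^*_R(n,\Diamond)\le \Bigl(3+\tfrac16+o(1)\Bigr)\binom{n}{\lfloor n/2\rfloor}.\]
   Context: All posets are finite. A subfamily of a family of sets is a copy of a poset $P$ if, ordered by inclusion, it is isomorphic to $P$. A coloring of a family $\mathcal{F}$ of sets is proper if $F\subsetneq F'$ in $\mathcal{F}$ implies $F,F'$ get different colors; a copy is rainbow if all its members receive distinct colors. $\mathrm{La}^*_R(n,P)$ is the maximum size of a family $\mathcal{F}\subseteq 2^{[n]}$ admitting a proper coloring with no rainbow copy of $P$. The diamond $\Diamond$ is the four-element poset $\{a,b,c,d\}$ with $a<b<d$, $a<c<d$ and $b,c$ incomparable. *)

theory Defs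
  imports Complex_Main "HOL-Library.Landau_Symbols"
begin

text \<open>A poset is given by its reflexive order relation \<open>P\<close>; its ground set is \<open>Field P\<close>. A copy is
  an induced (strong) copy: both comparabilities and incomparabilities are preserved.\<close>

definition is_copy :: "'p rel \<Rightarrow> 'a set set \<Rightarrow> bool" where
  "is_copy P G \<longleftrightarrow>
     (\<exists>f. bij_betw f (Field P) G \<and>
          (\<forall>x\<in>Field P. \<forall>y\<in>Field P. (x, y) \<in> P \<longleftrightarrow> f x \<subseteq> f y))"

definition proper_coloring :: "('a set \<Rightarrow> 'c) \<Rightarrow> 'a set set \<Rightarrow> bool" where
  "proper_coloring c \<F> \<longleftrightarrow> (\<forall>F\<in>\<F>. \<forall>F'\<in>\<F>. F \<subset> F' \<longrightarrow> c F \<noteq> c F')"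

definition rainbow :: "('a set \<Rightarrow> 'c) \<Rightarrow> 'a set set \<Rightarrow> bool" where
  "rainbow c G \<longleftrightarrow> inj_on c G"

text \<open>The number of colors is unrestricted; since the families below are finite, taking natural
  numbers as colors is no loss of generality.\<close>

definition rainbow_avoiding :: "'p rel \<Rightarrow> 'a set set \<Rightarrow> bool" where
  "rainbow_avoiding P \<F> \<longleftrightarrow>
     (\<exists>c :: 'a set \<Rightarrow> nat. proper_coloring c \<F> \<and>
        \<not> (\<exists>G\<subseteq>\<F>. is_copy P G \<and> rainbow c G))"

definition La_R :: "nat \<Rightarrow> 'p rel \<Rightarrow> nat" where
  "La_R n P = Max {card \<F> |\<F>. \<F> \<subseteq> Pow {1..n} \<and> rainbow_avoiding P \<F>}"

datatype diamond_elem = Dia_a | Dia_b | Dia_c | Dia_d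

definition diamond :: "diamond_elem rel" where
  "diamond = Id \<union> {(Dia_a, Dia_b), (Dia_a, Dia_c), (Dia_a, Dia_d), (Dia_b, Dia_d), (Dia_c, Dia_d)}"

lemma Field_diamond: "Field diamond = UNIV"
  by (auto simp: diamond_def Field_def)

lemma Partial_order_diamond: "Partial_order diamond"
  unfolding partial_order_on_def preorder_on_def Field_diamond
  by (auto simp: diamond_def refl_on_def trans_def antisym_def)

text \<open>The maximum in \<open>La_R\<close> is over a finite set, which is nonempty as soon as \<open>P\<close> is a nonempty poset.\<close>

lemma La_R_finite: "finite {card \<F> |\<F>. \<F> \<subseteq> Pow {1..n::nat} \<and> rainbow_avoiding P \<F>}"
proof -
  have "{card \<F> |\<F>. \<F> \<subseteq> Pow {1..n} \<and> rainbow_avoiding P \<F>} \<subseteq> card ` Pow (Pow {1..n})"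
    by auto
  then show ?thesis
    by (rule finite_subset) simp
qed

lemma La_R_nonempty:
  assumes "P \<noteq> {}"
  shows "{card \<F> |\<F>. \<F> \<subseteq> Pow {1..n::nat} \<and> rainbow_avoiding P \<F>} \<noteq> {}"
proof -
  have "Field P \<noteq> {}"
    using assms by (auto simp: Field_def)
  then have "\<not> is_copy P ({} :: nat set set)"
    by (auto simp: is_copy_def bij_betw_def)
  then have "rainbow_avoiding P ({} :: nat set set)"
    by (auto simp: rainbow_avoiding_def proper_coloring_def)
  then show ?thesis
    by blast
qed

end

(* The bounds hold with explicit error terms, the upper one with none: the Lubell function
   sum_{x in F} 1 / C(n, |x|) of a family F with a good coloring is at most 3 + 1/6.

   Relativised to an interval [A, D], the Lubell function of F is the average of its values on the
   intervals [A, D - {s}] if D is not in F, and on [A + s, D] if A is not in F. So one may assume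
   that A and D lie in F. Then incomparable members of F strictly between A and D have the same
   color and comparable ones different colors, so incomparability is transitive there: these members
   form antichains L_1 < L_2 < ..., every member of L_i lying below every member of L_(i+1). Such a
   weakly ordered family has Lubell function at most 7/6 in the open interval, by peeling off the
   lowest antichain, and A and D contribute 2 more. The value 7/6 is attained for |D - A| = 4 by two
   atoms, their union, and the two coatoms above it.

   For the lower bound, color three middle levels by cardinality. *)

theory Submission
  imports Defs
begin

section \<open>Lubell functions of intervals: additivity, averaging, LYM\<close>

text \<open>For finite \<open>D\<close> containing \<open>A\<close>, this is the expected number of
  members of \<open>F\<close> on a uniformly random maximal chain from \<open>A\<close> to
  \<open>D\<close>. The filter sits inside the sum, so that inductions can shrink the interval and
  keep \<open>F\<close>.\<close>

definition lubell :: "'a set \<Rightarrow> 'a set \<Rightarrow> 'a set set \<Rightarrow> real" where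
  "lubell A D F = (\<Sum>x\<in>{x\<in>F. A \<subseteq> x \<and> x \<subseteq> D}. 1 / real (card (D - A) choose card (x - A)))"

lemma finite_between: "finite D \<Longrightarrow> finite {x\<in>F. A \<subseteq> x \<and> x \<subseteq> D}"
  by (rule finite_subset[of _ "Pow D"]) auto

lemma lubell_cong:
  "{x\<in>F. A \<subseteq> x \<and> x \<subseteq> D} = {x\<in>G. A \<subseteq> x \<and> x \<subseteq> D} \<Longrightarrow> lubell A D F = lubell A D G"
  by (simp add: lubell_def)

lemma lubell_union_disjoint:
  assumes "finite D" "F \<inter> G = {}"
  shows "lubell A D (F \<union> G) = lubell A D F + lubell A D G"
proof -
  have "{x\<in>F \<union> G. A \<subseteq> x \<and> x \<subseteq> D} = {x\<in>F. A \<subseteq> x \<and> x \<subseteq> D} \<union> {x\<in>G. A \<subseteq> x \<and> x \<subseteq> D}"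
    by auto
  moreover have "{x\<in>F. A \<subseteq> x \<and> x \<subseteq> D} \<inter> {x\<in>G. A \<subseteq> x \<and> x \<subseteq> D} = {}"
    using assms by auto
  ultimately show ?thesis
    by (simp add: lubell_def sum.union_disjoint finite_between[OF assms(1)])
qed

lemma lubell_singleton:
  assumes "A \<subseteq> x" "x \<subseteq> D"
  shows "lubell A D {x} = 1 / real (card (D - A) choose card (x - A))"
proof -
  have "{y\<in>{x}. A \<subseteq> y \<and> y \<subseteq> D} = {x}"
    using assms by auto
  then show ?thesis by (simp add: lubell_def)
qed

lemma lubell_empty [simp]: "lubell A D {} = 0"
  by (simp add: lubell_def)

text \<open>Weights are compared term by term; the right side may only have further nonnegative
  terms. With \<open>r\<close> below 1, passing to a smaller interval becomes a gain.\<close>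

lemma lubell_le_scaled:
  assumes fin: "finite D" "finite D'"
    and sub: "\<And>x. x \<in> F \<Longrightarrow> A \<subseteq> x \<Longrightarrow> x \<subseteq> D \<Longrightarrow> A' \<subseteq> x \<and> x \<subseteq> D'"
    and le: "\<And>x. x \<in> F \<Longrightarrow> A \<subseteq> x \<Longrightarrow> x \<subseteq> D \<Longrightarrow>
      1 / real (card (D - A) choose card (x - A)) \<le> r * (1 / real (card (D' - A') choose card (x - A')))"
    and "r \<ge> 0"
  shows "lubell A D F \<le> r * lubell A' D' F"
proof -
  have "lubell A D F \<le> (\<Sum>x\<in>{x\<in>F. A \<subseteq> x \<and> x \<subseteq> D}. r * (1 / real (card (D' - A') choose card (x - A'))))"
    unfolding lubell_def by (rule sum_mono) (use le in auto)
  also have "\<dots> \<le> (\<Sum>x\<in>{x\<in>F. A' \<subseteq> x \<and> x \<subseteq> D'}. r * (1 / real (card (D' - A') choose card (x - A'))))"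
    by (rule sum_mono2) (use finite_between[OF fin(2)] sub \<open>r \<ge> 0\<close> in fastforce)+
  finally show ?thesis by (simp add: lubell_def sum_distrib_left)
qed

text \<open>The weight identity behind \<open>lubell_average_top\<close>: a set of relative size
  \<open>k\<close> survives the removal of \<open>m - k\<close> of the \<open>m\<close> elements,
  each time with weight \<open>1 / ((m - 1) choose k)\<close>.\<close>

lemma inverse_binomial_absorb:
  assumes "k < m"
  shows "real m / real (m choose k) = real (m - k) / real ((m - 1) choose k)"
proof -
  have "(m - k) * (m choose k) = m * ((m - 1) choose k)"
    using binomial_absorb_comp[of m k] .
  then have "real (m - k) * real (m choose k) = real m * real ((m - 1) choose k)"
    by (metis of_nat_mult)
  moreover have "m choose k > 0" "(m - 1) choose k > 0"
    using assms by auto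
  ultimately show ?thesis
    by (simp add: field_simps)
qed

text \<open>Double counting of the pairs of \<open>s\<close> and \<open>x\<close> with
  \<open>s \<notin> x\<close>. \<open>D\<close> has to be excluded because it lies in none of the
  smaller intervals.\<close>

lemma lubell_average_top:
  assumes fin: "finite D" and A: "A \<subset> D" and D: "D \<notin> F"
  shows "real (card (D - A)) * lubell A D F = (\<Sum>s\<in>D - A. lubell A (D - {s}) F)"
proof -
  let ?m = "card (D - A)"
  let ?X = "{x\<in>F. A \<subseteq> x \<and> x \<subseteq> D}"
  let ?w = "\<lambda>x. 1 / real ((?m - 1) choose card (x - A))"
  have fX: "finite ?X" using finite_between[OF fin] .
  have "(\<Sum>s\<in>D - A. lubell A (D - {s}) F) = (\<Sum>s\<in>D - A. \<Sum>x | x \<in> ?X \<and> s \<notin> x. ?w x)"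
  proof (rule sum.cong[OF refl])
    fix s assume s: "s \<in> D - A"
    have "{x\<in>F. A \<subseteq> x \<and> x \<subseteq> D - {s}} = {x. x \<in> ?X \<and> s \<notin> x}"
      using s by auto
    moreover have "card (D - {s} - A) = ?m - 1"
    proof -
      have "D - {s} - A = (D - A) - {s}" by auto
      then show ?thesis using s fin by simp
    qed
    ultimately show "lubell A (D - {s}) F = (\<Sum>x | x \<in> ?X \<and> s \<notin> x. ?w x)"
      by (simp add: lubell_def)
  qed
  also have "\<dots> = (\<Sum>x\<in>?X. \<Sum>s | s \<in> D - A \<and> s \<notin> x. ?w x)"
    by (rule sum.swap_restrict) (use fin fX in auto)
  also have "\<dots> = (\<Sum>x\<in>?X. real ?m * (1 / real (?m choose card (x - A))))"
  proof (rule sum.cong[OF refl])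
    fix x assume x: "x \<in> ?X"
    then have "x \<subset> D" using D by auto
    have "{s. s \<in> D - A \<and> s \<notin> x} = (D - A) - (x - A)" using x by auto
    moreover have "card ((D - A) - (x - A)) = ?m - card (x - A)"
      by (rule card_Diff_subset) (use x fin finite_subset[of x D] in auto)
    moreover have "card (x - A) < ?m"
      by (rule psubset_card_mono) (use fin x \<open>x \<subset> D\<close> in auto)
    ultimately show "(\<Sum>s | s \<in> D - A \<and> s \<notin> x. ?w x) = real ?m * (1 / real (?m choose card (x - A)))"
      using inverse_binomial_absorb[of "card (x - A)" ?m] by simp
  qed
  finally show ?thesis by (simp add: lubell_def sum_distrib_left)
qed

text \<open>The dual count, over pairs with \<open>s \<in> x\<close>: a set of relative size
  \<open>k\<close> lies in \<open>k\<close> of the smaller intervals. Excluding \<open>A\<close>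
  ensures \<open>k > 0\<close>, so that \<open>k - 1\<close> is not truncated.\<close>

lemma lubell_average_bot:
  assumes fin: "finite D" and A: "A \<subset> D" and D: "A \<notin> F"
  shows "real (card (D - A)) * lubell A D F = (\<Sum>s\<in>D - A. lubell (insert s A) D F)"
proof -
  let ?m = "card (D - A)"
  let ?X = "{x\<in>F. A \<subseteq> x \<and> x \<subseteq> D}"
  let ?w = "\<lambda>x. 1 / real ((?m - 1) choose (card (x - A) - 1))"
  have fX: "finite ?X" using finite_between[OF fin] .
  have "(\<Sum>s\<in>D - A. lubell (insert s A) D F) = (\<Sum>s\<in>D - A. \<Sum>x | x \<in> ?X \<and> s \<in> x. ?w x)"
  proof (rule sum.cong[OF refl])
    fix s assume s: "s \<in> D - A"
    have "{x\<in>F. insert s A \<subseteq> x \<and> x \<subseteq> D} = {x. x \<in> ?X \<and> s \<in> x}"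
      using s by auto
    moreover have "card (x - insert s A) = card (x - A) - 1" if "s \<in> x" for x
    proof -
      have "x - insert s A = (x - A) - {s}" by auto
      then show ?thesis using s that by simp
    qed
    moreover have "card (D - insert s A) = ?m - 1"
    proof -
      have "D - insert s A = (D - A) - {s}" by auto
      then show ?thesis using s fin by simp
    qed
    ultimately show "lubell (insert s A) D F = (\<Sum>x | x \<in> ?X \<and> s \<in> x. ?w x)"
      by (simp add: lubell_def)
  qed
  also have "\<dots> = (\<Sum>x\<in>?X. \<Sum>s | s \<in> D - A \<and> s \<in> x. ?w x)"
    by (rule sum.swap_restrict) (use fin fX in auto)
  also have "\<dots> = (\<Sum>x\<in>?X. real ?m * (1 / real (?m choose card (x - A))))"
  proof (rule sum.cong[OF refl])
    fix x assume x: "x \<in> ?X"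
    let ?k = "card (x - A)"
    have "A \<subset> x" "finite x" using x D fin finite_subset by auto
    have "{s. s \<in> D - A \<and> s \<in> x} = x - A" using x by auto
    moreover have k: "?k > 0" using \<open>A \<subset> x\<close> \<open>finite x\<close> by (auto simp: card_gt_0_iff)
    moreover have km: "?k \<le> ?m" by (rule card_mono) (use fin x in auto)
    moreover have "real ?k * real (?m choose ?k) = real ?m * real ((?m - 1) choose (?k - 1))"
      using times_binomial_minus1_eq[OF k, of ?m] by (metis of_nat_mult)
    moreover have "?m choose ?k > 0" "(?m - 1) choose (?k - 1) > 0"
      using k km by auto
    ultimately show "(\<Sum>s | s \<in> D - A \<and> s \<in> x. ?w x) = real ?m * (1 / real (?m choose ?k))"
      by (simp add: field_simps)
  qed
  finally show ?thesis by (simp add: lubell_def sum_distrib_left)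
qed

lemma le_of_average_le:
  assumes "finite S" "S \<noteq> {}" "real (card S) * a = (\<Sum>s\<in>S. f s)" "\<And>s. s \<in> S \<Longrightarrow> f s \<le> b"
  shows "a \<le> b"
proof -
  have "real (card S) * a \<le> real (card S) * b"
    using sum_bounded_above[of S f b] assms by simp
  moreover have "card S > 0" using assms by (simp add: card_gt_0_iff)
  ultimately show ?thesis by simp
qed

text \<open>The LYM inequality. If \<open>D\<close> is a member, an antichain has no other member in
  the interval; otherwise one averages over the intervals that end in a coatom.\<close>

lemma lubell_antichain_le_1:
  assumes "finite D" "A \<subseteq> D" "\<And>x y. x \<in> F \<Longrightarrow> y \<in> F \<Longrightarrow> \<not> x \<subset> y"
  shows "lubell A D F \<le> 1"
  using assms(1,2)
proof (induction "card D" arbitrary: D rule: less_induct)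
  case less
  show ?case
  proof (cases "D \<in> F")
    case True
    then have "lubell A D F = lubell A D {D}"
      using assms(3) less.prems by (intro lubell_cong) blast
    then show ?thesis
      using less.prems by (simp add: lubell_singleton)
  next
    case False
    show ?thesis
    proof (cases "A = D")
      case True
      then have "lubell A D F = lubell A D {}"
        using False by (intro lubell_cong) auto
      then show ?thesis by simp
    next
      case ne: False
      show ?thesis
      proof (rule le_of_average_le)
        show "real (card (D - A)) * lubell A D F = (\<Sum>s\<in>D - A. lubell A (D - {s}) F)"
          by (rule lubell_average_top) (use less.prems False ne in auto)
        fix s assume "s \<in> D - A"
        then show "lubell A (D - {s}) F \<le> 1"
          using less.prems by (intro less.hyps card_Diff1_less) auto
      qed (use less.prems ne in auto)
    qed
  qed
qed

section \<open>Comparing Lubell functions of nested intervals\<close>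

text \<open>By absorption, \<open>e choose j\<close> over \<open>m choose j\<close> equals
  \<open>e / m\<close> times the same ratio with all three entries lowered by 1, and that ratio is
  at most 1. For \<open>j = 0\<close> both weights are 1 and nothing is gained.\<close>

lemma binomial_ratio_le:
  assumes "e \<le> m" "0 < m" "1 \<le> j" "j \<le> e"
  shows "1 / real (m choose j) \<le> (real e / real m) * (1 / real (e choose j))"
proof -
  have "j * ((e choose j) * m) = e * m * ((e - 1) choose (j - 1))"
    using times_binomial_minus1_eq[of j e] assms by (simp add: algebra_simps)
  also have "\<dots> \<le> e * m * ((m - 1) choose (j - 1))"
    using assms by (intro mult_left_mono binomial_right_mono) auto
  also have "\<dots> = j * ((m choose j) * e)"
    using times_binomial_minus1_eq[of j m] assms by (simp add: algebra_simps)
  finally have "(e choose j) * m \<le> (m choose j) * e"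
    using assms by simp
  then have "real (e choose j) * real m \<le> real (m choose j) * real e"
    by (metis of_nat_le_iff of_nat_mult)
  moreover have "e choose j > 0" "m choose j > 0" using assms by auto
  ultimately show ?thesis using assms by (simp add: field_simps)
qed

text \<open>One absorption on each side reduces this to \<open>binomial_ratio_le\<close> with all
  entries lowered by 1, so \<open>j \<ge> 2\<close> earns the second factor.\<close>

lemma binomial_ratio_le2:
  assumes "e \<le> m" "2 \<le> j" "j \<le> e"
  shows "1 / real (m choose j) \<le>
    (real e * (real e - 1) / (real m * (real m - 1))) * (1 / real (e choose j))"
proof -
  have step: "1 / real (k choose j) = real j / real k * (1 / real ((k - 1) choose (j - 1)))"
    if "j \<le> k" for k
  proof -
    have "real j * real (k choose j) = real k * real ((k - 1) choose (j - 1))"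
      using times_binomial_minus1_eq[of j k] assms by (metis of_nat_mult pos2 less_le_trans)
    moreover have "k choose j > 0" "(k - 1) choose (j - 1) > 0" using that assms by auto
    ultimately show ?thesis using that assms by (simp add: field_simps)
  qed
  have "1 / real ((m - 1) choose (j - 1)) \<le>
      (real (e - 1) / real (m - 1)) * (1 / real ((e - 1) choose (j - 1)))"
    by (rule binomial_ratio_le) (use assms in auto)
  then have "1 / real (m choose j) \<le>
      real j / real m * ((real (e - 1) / real (m - 1)) * (1 / real ((e - 1) choose (j - 1))))"
    unfolding step[OF order_trans[OF assms(3,1)]] by (rule mult_left_mono) simp
  also have "\<dots> = (real e * (real e - 1) / (real m * (real m - 1))) * (1 / real (e choose j))"
    unfolding step[OF assms(3)] using assms by (simp add: field_simps of_nat_diff)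
  finally show ?thesis .
qed

text \<open>Binomial coefficients increase up to the middle; past it, \<open>p\<close> is replaced
  by \<open>m - p\<close>, which is still at least 2.\<close>

lemma binomial_ge_choose_2:
  assumes "2 \<le> p" "p + 2 \<le> m"
  shows "m choose 2 \<le> m choose p"
proof (cases "2 * p \<le> m")
  case True
  then show ?thesis using assms by (intro binomial_mono) auto
next
  case False
  have "m choose 2 \<le> m choose (m - p)" using False assms by (intro binomial_mono) auto
  then show ?thesis using assms by (simp add: binomial_symmetric[of p m])
qed


text \<open>Lowering the top from \<open>D\<close> to \<open>P\<close> gains on every set of
  positive relative size, hence on all sets but \<open>A\<close>. \<open>P\<close> itself may be a
  member.\<close>

lemma lubell_le_within:
  assumes "finite D" "A \<subseteq> P" "P \<subseteq> D" "A \<noteq> D" "\<And>x. x \<in> F \<Longrightarrow> A \<subset> x \<and> x \<subseteq> P"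
  shows "lubell A D F \<le> real (card (P - A)) / real (card (D - A)) * lubell A P F"
proof (rule lubell_le_scaled)
  show "finite P" using finite_subset[OF assms(3,1)] .
  fix x assume "x \<in> F"
  then have x: "A \<subset> x" "x \<subseteq> P" using assms(5) by auto
  then show "A \<subseteq> x \<and> x \<subseteq> P" by auto
  have "card (P - A) \<le> card (D - A)" "card (x - A) \<le> card (P - A)"
    using assms x \<open>finite P\<close> by (auto intro!: card_mono)
  moreover have "card (x - A) > 0" "card (D - A) > 0"
    using x assms finite_subset[OF x(2) \<open>finite P\<close>] by (auto simp: card_gt_0_iff)
  ultimately show "1 / real (card (D - A) choose card (x - A)) \<le>
      real (card (P - A)) / real (card (D - A)) * (1 / real (card (P - A) choose card (x - A)))"
    by (intro binomial_ratio_le) auto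
qed (use assms in auto)

lemma card_Diff_add:
  assumes "finite C" "A \<subseteq> B" "B \<subseteq> C"
  shows "card (C - A) = card (B - A) + card (C - B)"
proof -
  have "C - A = (B - A) \<union> (C - B)" using assms by auto
  moreover have "finite B" using assms finite_subset by auto
  ultimately show ?thesis using assms by (simp add: card_Un_disjoint disjoint_iff)
qed

text \<open>Raising the bottom from \<open>A\<close> to \<open>P\<close> is dual: by symmetry of
  binomials the distance \<open>card (D - x)\<close> to the top replaces the relative size, and it
  is positive for all sets but \<open>D\<close>.\<close>

lemma lubell_le_above:
  assumes "finite D" "A \<subseteq> P" "P \<subseteq> D" "A \<noteq> D"
    and F: "\<And>x. x \<in> F \<Longrightarrow> P \<subseteq> x \<and> x \<subset> D"
  shows "lubell A D F \<le> real (card (D - P)) / real (card (D - A)) * lubell P D F"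
proof (rule lubell_le_scaled)
  fix x assume "x \<in> F"
  then have x: "P \<subseteq> x" "x \<subset> D" using F by auto
  then show "P \<subseteq> x \<and> x \<subseteq> D" by auto
  let ?j = "card (D - x)"
  have "card (D - A) = card (x - A) + ?j" "card (D - P) = card (x - P) + ?j"
      "card (D - A) = card (P - A) + card (D - P)"
    using x assms by (auto intro!: card_Diff_add)
  moreover from this have "card (D - A) choose card (x - A) = card (D - A) choose ?j"
      "card (D - P) choose card (x - P) = card (D - P) choose ?j"
    using binomial_symmetric[of ?j "card (D - A)"] binomial_symmetric[of ?j "card (D - P)"] by auto
  moreover have "?j > 0" using x assms by (auto simp: card_gt_0_iff)
  ultimately show "1 / real (card (D - A) choose card (x - A)) \<le>
      real (card (D - P)) / real (card (D - A)) * (1 / real (card (D - P) choose card (x - P)))"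
    using binomial_ratio_le[of "card (D - P)" "card (D - A)" ?j] by simp
qed (use assms in auto)

text \<open>Away from the coatoms the distance to the top is at least 2, so the stronger ratio of
  \<open>binomial_ratio_le2\<close> applies.\<close>

lemma lubell_le_above2:
  assumes "finite D" "A \<subseteq> P" "P \<subseteq> D"
    and F: "\<And>x. x \<in> F \<Longrightarrow> P \<subseteq> x \<and> x \<subseteq> D \<and> 2 \<le> card (D - x)"
  shows "lubell A D F \<le>
    real (card (D - P)) * (real (card (D - P)) - 1) / (real (card (D - A)) * (real (card (D - A)) - 1))
      * lubell P D F"
proof (rule lubell_le_scaled)
  fix x assume "x \<in> F"
  then have x: "P \<subseteq> x" "x \<subseteq> D" "2 \<le> card (D - x)" using F by auto
  then show "P \<subseteq> x \<and> x \<subseteq> D" by auto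
  let ?j = "card (D - x)"
  have "card (D - A) = card (x - A) + ?j" "card (D - P) = card (x - P) + ?j"
      "card (D - A) = card (P - A) + card (D - P)"
    using x assms by (auto intro!: card_Diff_add)
  moreover from this have "card (D - A) choose card (x - A) = card (D - A) choose ?j"
      "card (D - P) choose card (x - P) = card (D - P) choose ?j"
    using binomial_symmetric[of ?j "card (D - A)"] binomial_symmetric[of ?j "card (D - P)"] by auto
  ultimately show "1 / real (card (D - A) choose card (x - A)) \<le>
      real (card (D - P)) * (real (card (D - P)) - 1) / (real (card (D - A)) * (real (card (D - A)) - 1))
      * (1 / real (card (D - P) choose card (x - P)))"
    using binomial_ratio_le2[of "card (D - P)" "card (D - A)" ?j] x by simp
next
  have nn: "real k * (real k - 1) \<ge> 0" for k by (cases k) auto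
  show "0 \<le> real (card (D - P)) * (real (card (D - P)) - 1) / (real (card (D - A)) * (real (card (D - A)) - 1))"
    by (intro divide_nonneg_nonneg nn)
qed (use assms in auto)

section \<open>Weakly ordered families\<close>

text \<open>Transitivity of incomparability. Excluding \<open>x \<subset> z\<close> is enough
  because the premises are symmetric in \<open>x\<close> and \<open>z\<close>; the case
  \<open>x = z\<close> stays allowed.\<close>

definition weak_ordered :: "'a set set \<Rightarrow> bool" where
  "weak_ordered G \<longleftrightarrow> (\<forall>x\<in>G. \<forall>y\<in>G. \<forall>z\<in>G.
     \<not> x \<subseteq> y \<longrightarrow> \<not> y \<subseteq> x \<longrightarrow> \<not> y \<subseteq> z \<longrightarrow> \<not> z \<subseteq> y \<longrightarrow> \<not> x \<subset> z)"

lemma weak_ordered_subset: "weak_ordered G \<Longrightarrow> H \<subseteq> G \<Longrightarrow> weak_ordered H"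
  unfolding weak_ordered_def by blast

lemma finite_minimal_below:
  assumes "finite G" "x \<in> G"
  obtains y where "y \<in> G" "y \<subseteq> x" "\<And>z. z \<in> G \<Longrightarrow> \<not> z \<subset> y"
proof -
  have "finite {y\<in>G. y \<subseteq> x}" "{y\<in>G. y \<subseteq> x} \<noteq> {}" using assms by auto
  from finite_has_minimal[OF this] show ?thesis
    using that by (metis (mono_tags, lifting) mem_Collect_eq order.trans psubset_eq)
qed

text \<open>Otherwise \<open>x\<close> would be incomparable to \<open>y\<close> and also to a
  minimal \<open>z\<close> below \<open>y\<close>, although \<open>z \<subset> y\<close>. This is
  what lets the lowest antichain be peeled off: all other members contain its union.\<close>

lemma weak_ordered_minimal_below:
  assumes "weak_ordered G" "finite G" "x \<in> G" "y \<in> G"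
    and "\<And>z. z \<in> G \<Longrightarrow> \<not> z \<subset> x" and "\<exists>z\<in>G. z \<subset> y"
  shows "x \<subset> y"
proof (rule ccontr)
  assume n: "\<not> x \<subset> y"
  obtain w where "w \<in> G" "w \<subset> y" using assms by auto
  from finite_minimal_below[OF assms(2) \<open>w \<in> G\<close>] obtain z where
    z: "z \<in> G" "z \<subseteq> w" "\<And>u. u \<in> G \<Longrightarrow> \<not> u \<subset> z" by blast
  have "z \<subset> y" using z(2) \<open>w \<subset> y\<close> by blast
  have "x \<noteq> y" using assms(5)[OF z(1)] \<open>z \<subset> y\<close> by blast
  then have "\<not> x \<subseteq> y" "\<not> y \<subseteq> x" using n assms(5)[OF \<open>y \<in> G\<close>] by auto
  moreover have "\<not> x \<subseteq> z" "\<not> z \<subseteq> x"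
    using n \<open>z \<subset> y\<close> z(3)[OF \<open>x \<in> G\<close>] assms(5)[OF z(1)] by auto
  ultimately show False
    using assms(1) \<open>x \<in> G\<close> \<open>y \<in> G\<close> z(1) \<open>z \<subset> y\<close> unfolding weak_ordered_def by blast
qed

text \<open>With \<open>M = m * (m - 1)\<close>, the first term is at most
  \<open>(1 - 12 / M) / 6\<close> and the second at most \<open>2 / M\<close>, which add up to
  exactly \<open>1 / 6\<close>.\<close>

lemma weak_bound_numeric:
  assumes "3 \<le> e" "2 \<le> p" "m = p + e"
  shows "real e * (real e - 1) / (real m * (real m - 1)) / 6 + 1 / real (m choose p) \<le> 1 / 6"
proof -
  have "2 * (m choose 2) = m * (m - 1)"
    using times_binomial_minus1_eq[of 2 m] by simp
  then have "2 * real (m choose 2) = real m * real (m - 1)"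
    by (metis of_nat_mult of_nat_numeral)
  then have "real (m choose 2) = real m * (real m - 1) / 2"
    using assms by (simp add: of_nat_diff)
  moreover have "real (m choose 2) \<le> real (m choose p)"
    using binomial_ge_choose_2[of p m] assms by simp
  ultimately have c: "real m * (real m - 1) / 2 \<le> real (m choose p)" by simp
  define M where "M = real m * (real m - 1)"
  have M: "M > 0" using assms by (simp add: M_def)
  have "1 / real (m choose p) \<le> 1 / (M / 2)"
    using c M assms by (intro divide_left_mono mult_pos_pos) (auto simp: M_def)
  \<comment> \<open>Here \<open>e \<le> m - 2\<close>. The next bound, by \<open>M - 12\<close>,
    amounts to \<open>18 \<le> 4 * m\<close>, which holds since \<open>m \<ge> 5\<close>.\<close>
  moreover have "real e * (real e - 1) \<le> (real m - 2) * (real m - 3)"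
    using assms by (intro mult_mono) auto
  then have "real e * (real e - 1) \<le> M - 12"
    using assms by (simp add: M_def algebra_simps)
  then have "real e * (real e - 1) / M / 6 \<le> (M - 12) / M / 6"
    using M by (intro divide_right_mono) auto
  moreover have "(M - 12) / M / 6 + 1 / (M / 2) = 1 / 6"
    using M by (simp add: field_simps)
  ultimately show ?thesis unfolding M_def by linarith
qed

lemma lubell_weak_ordered:
  assumes "finite D" "weak_ordered G" "\<And>x. x \<in> G \<Longrightarrow> A \<subset> x \<and> x \<subset> D"
  shows "lubell A D G \<le> 7 / 6"
  using assms
proof (induction "card (D - A)" arbitrary: A G rule: less_induct)
  case less
  show ?case
  proof (cases "G = {}")
    case False
    have finG: "finite G"
      by (rule finite_subset[of _ "Pow D"]) (use less.prems in auto)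
    \<comment> \<open>By LYM, the antichain \<open>L\<close> contributes at most \<open>p / m\<close> and the coatoms \<open>K\<close> above \<open>P\<close> at most
      \<open>e / m\<close>, which add up to \<open>1\<close>. The excess \<open>1 / 6\<close> has to cover \<open>P\<close> itself and \<open>H - K\<close>, to which
      the induction hypothesis applies with the smaller factor \<open>\<rho>2\<close>.\<close>
    define L where "L = {x\<in>G. \<forall>z\<in>G. \<not> z \<subset> x}"
    define P where "P = \<Union>L"
    define H where "H = {x\<in>G. P \<subset> x}"
    define K where "K = {x\<in>H. card (D - x) = 1}"
    \<comment> \<open>\<open>E\<close> is \<open>{P}\<close> or empty. Subtracting \<open>L\<close>
      matters when \<open>L\<close> is the singleton of \<open>P\<close>, which must not be counted
      twice.\<close>
    define E where "E = G \<inter> {P} - L"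
    obtain x1 where "x1 \<in> G" using False by auto
    from finite_minimal_below[OF finG this] obtain x0 where
      "x0 \<in> G" "\<And>z. z \<in> G \<Longrightarrow> \<not> z \<subset> x0" by blast
    then have "x0 \<in> L" unfolding L_def by simp
    have below: "x \<subset> y" if "x \<in> L" "y \<in> G - L" for x y
      using weak_ordered_minimal_below[OF less.prems(2) finG, of x y] that unfolding L_def by auto
    have P_le: "P \<subseteq> y" if "y \<in> G - L" for y
      using below that unfolding P_def by blast
    have LG: "L \<subseteq> G" and HG: "H \<subseteq> G" unfolding L_def H_def by auto
    have x0: "A \<subset> x0" "x0 \<subseteq> P" "x0 \<subset> D"
      using \<open>x0 \<in> L\<close> LG less.prems(3) unfolding P_def by auto
    have PD: "P \<subseteq> D" and AP: "A \<subset> P"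
      using LG less.prems(3) x0 unfolding P_def by auto
    have finP: "finite P" using finite_subset[OF PD less.prems(1)] .
    have LH: "L \<inter> H = {}" unfolding H_def P_def by auto
    have Gsplit: "G = L \<union> (E \<union> H)"
      using P_le LG unfolding E_def H_def by blast
    have disj: "L \<inter> (E \<union> H) = {}" "E \<inter> H = {}"
      using LH unfolding E_def H_def by auto
    let ?m = "card (D - A)" and ?p = "card (P - A)" and ?e = "card (D - P)"
    have mpe: "?m = ?p + ?e" by (rule card_Diff_add) (use less.prems AP PD in auto)
    have p1: "?p \<ge> 1" using AP finP by (auto simp: Suc_le_eq card_gt_0_iff)
    have AD: "A \<subset> D" using x0 by auto
    have "lubell A D L \<le> real ?p / real ?m * lubell A P L"
      by (rule lubell_le_within) (use less.prems AP PD AD LG in \<open>auto simp: P_def\<close>)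
    also have "\<dots> \<le> real ?p / real ?m * 1"
      by (intro mult_left_mono lubell_antichain_le_1) (use finP AP in \<open>auto simp: L_def\<close>)
    finally have fL: "lubell A D L \<le> real ?p / real ?m" by simp
    have total: "lubell A D G = lubell A D L + lubell A D E + lubell A D H"
      using disj less.prems(1) by (subst Gsplit) (simp add: lubell_union_disjoint)
    have Ksub: "K \<subseteq> H" unfolding K_def by auto
    have HD: "P \<subset> x" "x \<subset> D" if "x \<in> H" for x
      using that less.prems(3) HG unfolding H_def by auto
    have fH1: "lubell P D K \<le> 1"
    proof (rule lubell_antichain_le_1)
      fix x y assume "x \<in> K" "y \<in> K"
      then have "card (D - x) = card (D - y)" "y \<subseteq> D" using Ksub HD unfolding K_def by auto
      moreover have "card (D - y) < card (D - x)" if "x \<subset> y"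
        by (rule psubset_card_mono) (use that \<open>y \<subseteq> D\<close> less.prems(1) in auto)
      ultimately show "\<not> x \<subset> y" by auto
    qed (use less.prems PD in auto)
    have fH: "lubell P D H \<le> 7 / 6"
    proof (rule less.hyps)
      show "?e < ?m" using mpe p1 by simp
      show "weak_ordered H" using weak_ordered_subset[OF less.prems(2) HG] .
    qed (use less.prems HD in auto)
    define \<rho>1 where "\<rho>1 = real ?e / real ?m"
    define \<rho>2 where "\<rho>2 = real ?e * (real ?e - 1) / (real ?m * (real ?m - 1))"
    have HK: "lubell B D H = lubell B D K + lubell B D (H - K)" for B
      using lubell_union_disjoint[OF less.prems(1), of K "H - K" B] Ksub by (simp add: Un_absorb1)
    have K1: "lubell A D K \<le> \<rho>1 * lubell P D K"
      unfolding \<rho>1_def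
    proof (rule lubell_le_above)
      fix x assume "x \<in> K"
      then show "P \<subseteq> x \<and> x \<subset> D" using HD[of x] Ksub by auto
    qed (use less.prems AP PD AD in auto)
    have K2: "lubell A D (H - K) \<le> \<rho>2 * lubell P D (H - K)"
      unfolding \<rho>2_def
    proof (rule lubell_le_above2)
      fix x assume x: "x \<in> H - K"
      then have "card (D - x) > 0" using HD less.prems(1) by (auto simp: card_gt_0_iff)
      moreover have "card (D - x) \<noteq> 1" using x unfolding K_def by auto
      ultimately show "P \<subseteq> x \<and> x \<subseteq> D \<and> 2 \<le> card (D - x)" using HD x by auto
    qed (use less.prems AP PD in auto)
    have \<rho>2: "0 \<le> \<rho>2"
    proof -
      have "0 \<le> real k * (real k - 1)" for k by (cases k) auto
      then show ?thesis unfolding \<rho>2_def by (intro divide_nonneg_nonneg)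
    qed
    have \<rho>21: "\<rho>2 \<le> \<rho>1"
    proof (cases "?m \<ge> 2")
      case True
      have "(real ?e - 1) / (real ?m - 1) \<le> 1" using mpe True by (simp add: divide_le_eq)
      then have "\<rho>1 * ((real ?e - 1) / (real ?m - 1)) \<le> \<rho>1 * 1"
        by (intro mult_left_mono) (auto simp: \<rho>1_def)
      then show ?thesis by (simp add: \<rho>1_def \<rho>2_def)
    next
      case False
      \<comment> \<open>Here \<open>?m = 1\<close>, so the denominator of \<open>\<rho>2\<close>
        vanishes; but both numerators are 0.\<close>
      then have "?e = 0" using mpe p1 by linarith
      then show ?thesis by (simp add: \<rho>1_def \<rho>2_def)
    qed
    \<comment> \<open>Regrouping with the nonnegative coefficients \<open>\<rho>1 - \<rho>2\<close>
      and \<open>\<rho>2\<close> allows LYM to be used for \<open>K\<close> and the induction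
      hypothesis for all of \<open>H\<close>.\<close>
    have "lubell A D H \<le> \<rho>1 * lubell P D K + \<rho>2 * (lubell P D H - lubell P D K)"
      using HK[of A] HK[of P] K1 K2 by simp
    also have "\<dots> = (\<rho>1 - \<rho>2) * lubell P D K + \<rho>2 * lubell P D H"
      by (simp add: algebra_simps)
    also have "\<dots> \<le> (\<rho>1 - \<rho>2) * 1 + \<rho>2 * (7 / 6)"
      using fH1 fH \<rho>2 \<rho>21 by (intro add_mono mult_left_mono) auto
    finally have fHb: "lubell A D H \<le> \<rho>1 + \<rho>2 / 6" by simp
    have sum1: "real ?p / real ?m + \<rho>1 = 1"
      using mpe p1 by (simp add: \<rho>1_def flip: add_divide_distrib)
    show ?thesis
    proof (cases "E = {}")
      case True
      have "\<rho>1 \<le> 1" using mpe p1 by (simp add: \<rho>1_def divide_le_eq)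
      then show ?thesis using total fL fHb sum1 True \<rho>21 by simp
    next
      case False
      then have PE: "P \<in> G - L" "E = {P}" unfolding E_def by auto
      have fE: "lubell A D E = 1 / real (?m choose ?p)"
        using PE AP PD by (simp add: lubell_singleton)
      \<comment> \<open>Since \<open>P\<close> is not in \<open>L\<close>, the strict chain from
        \<open>A\<close> through \<open>x0\<close> to \<open>P\<close> forces
        \<open>?p \<ge> 2\<close>.\<close>
      have "x0 \<subset> P" using below \<open>x0 \<in> L\<close> PE by auto
      have "card (x0 - A) < ?p" by (rule psubset_card_mono) (use finP x0 \<open>x0 \<subset> P\<close> in auto)
      moreover have "card (x0 - A) > 0"
        using x0 finite_subset[OF x0(2) finP] by (auto simp: card_gt_0_iff)
      ultimately have p2: "?p \<ge> 2" by linarith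
      have e1: "?e \<ge> 1" using less.prems(3)[of P] PE less.prems(1) by (auto simp: Suc_le_eq card_gt_0_iff)
      have small: "card (D - x) < ?e" "card (D - x) > 0" if "x \<in> H" for x
      proof -
        show "card (D - x) < ?e" 
          by (rule psubset_card_mono) (use that HD[of x] less.prems(1) in auto)
        show "card (D - x) > 0" using that HD[of x] less.prems(1) by (auto simp: card_gt_0_iff)
      qed
      \<comment> \<open>For \<open>?e = 1\<close> nothing lies strictly between \<open>P\<close> and
        \<open>D\<close>, so \<open>P\<close> takes the share \<open>\<rho>1\<close> left free by
        \<open>H\<close>. For \<open>?e = 2\<close> all of \<open>H\<close> are coatoms, and
        \<open>P\<close> weighs at most \<open>1 / (4 choose 2)\<close>, which is the whole excess;
        the general estimate would fail at \<open>?m = 4\<close>.\<close>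
      consider "?e = 1" | "?e = 2" | "?e \<ge> 3" using e1 by linarith
      then show ?thesis
      proof cases
        case 1
        then have "H = {}" using small by fastforce
        moreover have "?m choose ?p = ?m" using mpe 1 by simp
        moreover have "real ?p / real ?m + 1 / real ?m = 1"
          using mpe 1 by (simp flip: add_divide_distrib)
        ultimately show ?thesis using total fL fE by simp
      next
        case 2
        then have "H = K" using small unfolding K_def by fastforce
        then have "lubell A D H \<le> \<rho>1 * 1"
          using K1 mult_left_mono[OF fH1, of \<rho>1] by (simp add: \<rho>1_def)
        moreover have "6 \<le> ?m choose ?p"
        proof -
          have "(4::nat) choose 2 \<le> ?m choose 2" using mpe 2 p2 by (intro binomial_right_mono) auto
          also have "\<dots> \<le> ?m choose ?p" using mpe 2 p2 by (intro binomial_ge_choose_2) auto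
          finally show ?thesis by (simp add: choose_two)
        qed
        then have "1 / real (?m choose ?p) \<le> 1 / 6"
          using mpe by (intro divide_left_mono) auto
        ultimately show ?thesis using total fL fE sum1 by simp
      next
        case 3
        then show ?thesis
          using weak_bound_numeric[OF 3 p2 mpe, folded \<rho>2_def] total fL fE fHb sum1 by linarith
      qed
    qed
  qed simp
qed

section \<open>The Lubell bound for whole families\<close>

text \<open>The hypothesis on \<open>F\<close> mentions neither \<open>A\<close> nor
  \<open>D\<close>, so it passes unchanged to the smaller intervals of the averaging steps.\<close>

lemma lubell_le_19_6:
  assumes "finite D" "A \<subseteq> D"
    and "\<And>B C. B \<in> F \<Longrightarrow> C \<in> F \<Longrightarrow> weak_ordered {x\<in>F. B \<subset> x \<and> x \<subset> C}"
  shows "lubell A D F \<le> 19 / 6"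
  using assms(1,2)
proof (induction "card (D - A)" arbitrary: A D rule: less_induct)
  case less
  have step: "card (D - {s} - A) < card (D - A)" "card (D - insert s A) < card (D - A)"
    if "s \<in> D - A" for s
    by (rule psubset_card_mono; use that less.prems in auto)+
  show ?case
  proof (cases "A = D")
    case True
    have "lubell A D F \<le> lubell A D {D}"
      unfolding lubell_def by (rule sum_mono2) (use True finite_between[OF less.prems(1)] in auto)
    then show ?thesis using True by (simp add: lubell_singleton)
  next
    case ne: False
    consider "D \<notin> F" | "A \<notin> F" | "A \<in> F" "D \<in> F" by auto
    then show ?thesis
    proof cases
      case 1
      show ?thesis
        by (rule le_of_average_le[OF _ _ lubell_average_top])
          (use 1 ne less step in auto)
    next
      case 2
      show ?thesis
        by (rule le_of_average_le[OF _ _ lubell_average_bot])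
          (use 2 ne less step in auto)
    next
      case 3
      let ?G = "{x\<in>F. A \<subset> x \<and> x \<subset> D}"
      have "lubell A D F = lubell A D ({A} \<union> ({D} \<union> ?G))"
        by (rule lubell_cong) (use 3 less.prems in auto)
      also have "\<dots> = 2 + lubell A D ?G"
        using less.prems ne by (simp add: lubell_union_disjoint lubell_singleton del: insert_is_Un Un_insert_left)
      also have "lubell A D ?G \<le> 7 / 6"
        by (rule lubell_weak_ordered) (use 3 assms(3) less.prems in auto)
      finally show ?thesis by simp
    qed
  qed
qed

section \<open>Colorings without a rainbow diamond and the upper bound\<close>

lemma is_copy_diamondI:
  assumes "A \<subset> x" "A \<subset> y" "x \<subset> D" "y \<subset> D" "\<not> x \<subseteq> y" "\<not> y \<subseteq> x"
  shows "is_copy diamond {A, x, y, D}"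
proof -
  define f where "f = case_diamond_elem A x y D"
  have f: "f Dia_a = A" "f Dia_b = x" "f Dia_c = y" "f Dia_d = D" by (auto simp: f_def)
  have U: "(UNIV :: diamond_elem set) = {Dia_a, Dia_b, Dia_c, Dia_d}"
    using diamond_elem.exhaust by auto
  have "bij_betw f UNIV {A, x, y, D}"
    unfolding bij_betw_def U using assms by (auto simp: f)
  moreover have "\<forall>u\<in>UNIV. \<forall>v\<in>UNIV. (u, v) \<in> diamond \<longleftrightarrow> f u \<subseteq> f v"
    unfolding U using assms by (auto simp: f diamond_def)
  ultimately show ?thesis unfolding is_copy_def Field_diamond by blast
qed

lemma rainbow_avoiding_diamond_weak_ordered:
  assumes "rainbow_avoiding diamond F" "A \<in> F" "D \<in> F"
  shows "weak_ordered {x\<in>F. A \<subset> x \<and> x \<subset> D}"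
proof -
  obtain c :: "'a set \<Rightarrow> nat" where c: "proper_coloring c F"
    and no: "\<And>G. G \<subseteq> F \<Longrightarrow> is_copy diamond G \<Longrightarrow> \<not> inj_on c G"
    using assms(1) unfolding rainbow_avoiding_def rainbow_def by auto
  have ne: "c x \<noteq> c y" if "x \<in> F" "y \<in> F" "x \<subset> y" for x y
    using c that unfolding proper_coloring_def by auto
  have eq: "c x = c y"
    if "x \<in> F" "y \<in> F" "A \<subset> x" "x \<subset> D" "A \<subset> y" "y \<subset> D" "\<not> x \<subseteq> y" "\<not> y \<subseteq> x" for x y
  proof (rule ccontr)
    assume "c x \<noteq> c y"
    \<comment> \<open>These five pairs are comparable, so properness separates them; only the two
      middle elements of a diamond can share a color.\<close>
    moreover have "c A \<noteq> c x" "c A \<noteq> c y" "c A \<noteq> c D" "c x \<noteq> c D" "c y \<noteq> c D"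
      using that assms ne by (auto simp: less_le_not_le intro!: ne)
    ultimately have "inj_on c {A, x, y, D}" by (auto simp: inj_on_def)
    then show False using no[OF _ is_copy_diamondI[of A x y D]] that assms by auto
  qed
  show ?thesis
    unfolding weak_ordered_def
  proof (intro ballI impI)
    fix x y z assume xyz: "x \<in> {x\<in>F. A \<subset> x \<and> x \<subset> D}" "y \<in> {x\<in>F. A \<subset> x \<and> x \<subset> D}" "z \<in> {x\<in>F. A \<subset> x \<and> x \<subset> D}"
      and "\<not> x \<subseteq> y" "\<not> y \<subseteq> x" "\<not> y \<subseteq> z" "\<not> z \<subseteq> y"
    then have "c x = c y" "c y = c z" by (auto intro!: eq)
    then show "\<not> x \<subset> z" using ne xyz by auto
  qed
qed

text \<open>The middle binomial coefficient is the largest, so every member has weight at least its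
  reciprocal.\<close>

lemma card_le_lubell:
  fixes n :: nat
  assumes "F \<subseteq> Pow {1..n}"
  shows "real (card F) \<le> lubell {} {1..n} F * real (n choose (n div 2))"
proof -
  have "(\<Sum>x\<in>F. 1 / real (n choose (n div 2))) \<le> (\<Sum>x\<in>F. 1 / real (n choose card x))"
  proof (rule sum_mono)
    fix x assume "x \<in> F"
    then have "card x \<le> n" using assms card_mono[of "{1..n}" x] by auto
    then show "1 / real (n choose (n div 2)) \<le> 1 / real (n choose card x)"
      by (intro divide_left_mono) (auto simp: binomial_maximum)
  qed
  moreover have "{x\<in>F. {} \<subseteq> x \<and> x \<subseteq> {1..n}} = F" using assms by auto
  ultimately have "real (card F) / real (n choose (n div 2)) \<le> lubell {} {1..n} F"
    by (simp add: lubell_def)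
  then show ?thesis by (simp add: divide_le_eq)
qed

lemma La_R_diamond_le: "real (La_R n diamond) \<le> 19 / 6 * real (n choose (n div 2))"
proof -
  have "diamond \<noteq> {}" by (auto simp: diamond_def)
  from Max_in[OF La_R_finite La_R_nonempty[OF this]]
  obtain F where F: "F \<subseteq> Pow {1..n}" "rainbow_avoiding diamond F" "La_R n diamond = card F"
    unfolding La_R_def by blast
  have "lubell {} {1..n} F \<le> 19 / 6"
    by (rule lubell_le_19_6) (use F rainbow_avoiding_diamond_weak_ordered in auto)
  then have "lubell {} {1..n} F * real (n choose (n div 2)) \<le> 19 / 6 * real (n choose (n div 2))"
    by (rule mult_right_mono) simp
  then show ?thesis using card_le_lubell[OF F(1)] F(3) by linarith
qed

section \<open>The lower bound from three levels\<close>

text \<open>Colored by cardinality, a rainbow diamond would need four different sizes, but only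
  three are available.\<close>

lemma rainbow_avoiding_three_levels:
  fixes F :: "'a set set"
  assumes "\<And>x. x \<in> F \<Longrightarrow> finite x \<and> k \<le> card x \<and> card x \<le> k + 2"
  shows "rainbow_avoiding diamond F"
  unfolding rainbow_avoiding_def
proof (intro exI[of _ card] conjI notI)
  show "proper_coloring card F"
    unfolding proper_coloring_def using assms psubset_card_mono by (metis less_irrefl)
  assume "\<exists>G\<subseteq>F. is_copy diamond G \<and> rainbow card G"
  then obtain G f where G: "G \<subseteq> F" "inj_on card G" and bij: "bij_betw f UNIV G"
    and f: "\<And>x y. (x, y) \<in> diamond \<longleftrightarrow> f x \<subseteq> f y"
    unfolding is_copy_def Field_diamond rainbow_def by auto
  have fG: "f u \<in> F" for u using bij_betw_apply[OF bij, of u] G(1) by auto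
  have inj: "card (f u) \<noteq> card (f v)" if "u \<noteq> v" for u v
  proof -
    have "f u \<noteq> f v" "f u \<in> G" "f v \<in> G"
      using bij that unfolding bij_betw_def inj_on_def by auto
    then show ?thesis using G(2) inj_onD by metis
  qed
  have lt: "card (f u) < card (f v)" if "(u, v) \<in> diamond" "u \<noteq> v" for u v
    using card_mono[of "f v" "f u"] inj[OF that(2)] f[of u v] that(1) assms[OF fG[of v]] by auto
  have "card (f Dia_a) < card (f Dia_b)" "card (f Dia_b) < card (f Dia_d)"
    "card (f Dia_a) < card (f Dia_c)" "card (f Dia_c) < card (f Dia_d)"
    by (auto intro!: lt simp: diamond_def)
  moreover have "k \<le> card (f Dia_a)" "card (f Dia_d) \<le> k + 2"
    using assms fG by auto
  moreover have "card (f Dia_b) \<noteq> card (f Dia_c)" by (rule inj) simp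
  ultimately show False by linarith
qed

text \<open>For \<open>k = 0\<close> truncated subtraction would make the levels
  \<open>k - 1\<close> and \<open>k\<close> coincide.\<close>

lemma La_R_diamond_ge_levels:
  assumes "0 < k"
  shows "(n choose (k - 1)) + (n choose k) + (n choose (k + 1)) \<le> La_R n diamond"
proof -
  let ?L = "\<lambda>j. {x. x \<subseteq> {1..n} \<and> card x = j}"
  let ?F = "?L (k - 1) \<union> ?L k \<union> ?L (k + 1)"
  have fin: "finite (?L j)" for j
    by (rule finite_subset[of _ "Pow {1..n}"]) auto
  have "rainbow_avoiding diamond ?F"
    by (rule rainbow_avoiding_three_levels[of _ "k - 1"]) (use finite_subset[of _ "{1..n}"] in auto)
  then have "card ?F \<in> {card \<F> |\<F>. \<F> \<subseteq> Pow {1..n} \<and> rainbow_avoiding diamond \<F>}"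
    by blast
  then have "card ?F \<le> La_R n diamond"
    unfolding La_R_def by (rule Max_ge[OF La_R_finite])
  moreover have "card ?F = card (?L (k - 1) \<union> ?L k) + card (?L (k + 1))"
    by (rule card_Un_disjoint) (use fin assms in auto)
  moreover have "card (?L (k - 1) \<union> ?L k) = card (?L (k - 1)) + card (?L k)"
    by (rule card_Un_disjoint) (use fin assms in auto)
  moreover have "card (?L j) = n choose j" for j
    using n_subsets[of "{1..n}" j] by simp
  ultimately show ?thesis by simp
qed

lemma La_R_diamond_ge:
  "(3 - 6 / real (n + 1)) * real (n choose (n div 2)) \<le> real (La_R n diamond)"
proof (cases "n \<ge> 2")
  case False
  then have "(3 - 6 / real (n + 1)) \<le> 0" by (auto simp: field_simps)
  then have "(3 - 6 / real (n + 1)) * real (n choose (n div 2)) \<le> 0"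
    by (rule mult_nonpos_nonneg) simp
  then show ?thesis by (rule order_trans) simp
next
  case True
  define k where "k = n div 2"
  define C where "C = real (n choose k)"
  have k: "k > 0" "2 * k \<le> n" "n \<le> 2 * k + 1" using True by (auto simp: k_def)
  have C: "C > 0" using k by (simp add: C_def)
  have "k * (n choose k) = (n - (k - 1)) * (n choose (k - 1))"
    using binomial_absorb_comp[of n "k - 1"] times_binomial_minus1_eq[of k n] k by simp
  then have "real k * C = real (n - (k - 1)) * real (n choose (k - 1))"
    unfolding C_def by (metis of_nat_mult)
  then have dn: "real (n choose (k - 1)) = real k / (real n - real k + 1) * C"
    using k by (simp add: field_simps of_nat_diff)
  have "(k + 1) * (n choose (k + 1)) = (n - k) * (n choose k)"
    using binomial_absorb_comp[of n k] times_binomial_minus1_eq[of "k + 1" n] by simp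
  then have "real (k + 1) * real (n choose (k + 1)) = real (n - k) * C"
    unfolding C_def by (metis of_nat_mult)
  then have up: "real (n choose (k + 1)) = (real n - real k) / (real k + 1) * C"
    using k by (simp add: field_simps of_nat_diff)
  have n: "n = 2 * k \<or> n = 2 * k + 1" using k by linarith
  \<comment> \<open>These are the ratios of the two neighboring binomials to the middle one. The
    lower ratio is worst for odd \<open>n\<close>, where it is \<open>1 - 4 / (n + 3)\<close>; the
    upper one for even \<open>n\<close>, where it is \<open>1 - 2 / (n + 2)\<close>. The losses 4
    and 2 add up to the constant 6.\<close>
  have "1 - 4 / (real n + 1) \<le> real k / (real n - real k + 1)"
    using n by (elim disjE) (use k in \<open>simp_all add: field_simps\<close>)
  moreover have "1 - 2 / (real n + 1) \<le> (real n - real k) / (real k + 1)"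
    using n by (elim disjE) (use k in \<open>simp_all add: field_simps\<close>)
  ultimately have "3 - 6 / real (n + 1) \<le> real k / (real n - real k + 1) + 1 + (real n - real k) / (real k + 1)"
    by (simp add: add.commute)
  then have "(3 - 6 / real (n + 1)) * C \<le> (real k / (real n - real k + 1) + 1 + (real n - real k) / (real k + 1)) * C"
    using C by (intro mult_right_mono) auto
  also have "\<dots> = real (n choose (k - 1)) + real (n choose k) + real (n choose (k + 1))"
    unfolding dn up by (simp add: C_def distrib_right)
  also have "\<dots> \<le> real (La_R n diamond)"
    using La_R_diamond_ge_levels[OF k(1), of n] by linarith
  finally show ?thesis by (simp add: C_def k_def)
qed

theorem theorem1p8:
  shows "\<exists>\<epsilon> \<delta> :: nat \<Rightarrow> real. \<epsilon> \<in> o(\<lambda>_. 1) \<and> \<delta> \<in> o(\<lambda>_. 1) \<and>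
    (\<forall>n. (3 + \<epsilon> n) * real (n choose (n div 2)) \<le> real (La_R n diamond) \<and>
         real (La_R n diamond) \<le> (3 + 1 / 6 + \<delta> n) * real (n choose (n div 2)))"
proof (intro exI conjI allI)
  have "(\<lambda>n. - 6 / real (n + 1)) \<longlonglongrightarrow> 0"
    using LIMSEQ_ignore_initial_segment[OF lim_const_over_n[of "-6::real"], of 1] by simp
  \<comment> \<open>Unification with this goal and the next fixes the witnesses:
    \<open>- 6 / (n + 1)\<close> for \<open>\<epsilon>\<close> and 0 for
    \<open>\<delta>\<close>.\<close>
  then show "(\<lambda>n. - 6 / real (n + 1)) \<in> o(\<lambda>_. 1 :: real)"
    by (intro smalloI_tendsto) auto
  show "(\<lambda>_. 0 :: real) \<in> o(\<lambda>_::nat. 1 :: real)" by simp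
  fix n :: nat
  show "(3 + - 6 / real (n + 1)) * real (n choose (n div 2)) \<le> real (La_R n diamond)"
    using La_R_diamond_ge[of n] by simp
  show "real (La_R n diamond) \<le> (3 + 1 / 6 + 0) * real (n choose (n div 2))"
    using La_R_diamond_le[of n] by simp
qed

end
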